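(* Let $F_q$ be a finite field of characteristic $q$ and let $(X,\mathcal{B},\mu,(T_f)_{f\in F_q[x]})$ be a measure preserving action of the additive group $(F_q[x],+)$. Then the system is strongly mixing if and only if for every $\epsilon>0$ and every $A\in\mathcal{B}$ with $\mu(A)>0$ the set $$\{f\in F_q[x]:|\mu(A\cap T_fA)-\mu(A)^2|<\epsilon\}$$ is a $\triangle^*$-set in $(F_q[x],+)$.
   Context: Here $q$ is prime and $F_q$ denotes a finite field of characteristic $q$. A measure preserving action (system) $(X,\mathcal{B},\mu,(T_g)_{g\in G})$ of a group $G$ consists of a probability space $(X,\mathcal{B},\mu)$ and an action of $G$ on $X$ by invertible measure preserving transformations $T_g:X\to X$. It is called strongly mixing (strong mixing) if for every $\epsilon>0$ and all $A,B\in\mathcal{B}$ with positive measure, the set $\{g\in G:|\mu(A\cap T_gB)-\mu(A)\mu(B)|<\epsilon\}$ is cofinite in $G$ (its complement is finite). A set $D\subseteq F_q[x]$ is a $\triangle$-set in $(F_q[x],+)$ if it contains an infinite difference set, i.e. there is a sequence $\langle x_n\rangle_{n=1}^{\infty}$ in $F_q[x]$ such that $\triangle(\langle x_n\rangle_{n=1}^\infty)=\{x_n-x_m:m,n\in\mathbb{N}\}$ is infinite and is contained in $D$. A set $D\subseteq F_q[x]$ is a $\triangle^*$-set if it has nonempty intersection with every $\triangle$-set. *)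

theory Defs
  imports
    "HOL-Probability.Probability_Measure"
    "HOL-Computational_Algebra.Polynomial"
begin

text \<open>
  Invertibility of each transformation, with measurable inverse \<open>T (- g)\<close>, follows from the action
  axioms; see \<open>bij_betw_T\<close> and \<open>T_image\<close> below.
\<close>

locale measure_preserving_action = prob_space M
  for M :: "'x measure" and T :: "'g::group_add \<Rightarrow> 'x \<Rightarrow> 'x" +
  assumes T_measurable: "T g \<in> measurable M M"
    and T_preserving: "A \<in> sets M \<Longrightarrow> emeasure M (T g -` A \<inter> space M) = emeasure M A"
    and T_zero: "x \<in> space M \<Longrightarrow> T 0 x = x"
    and T_add: "x \<in> space M \<Longrightarrow> T (g + h) x = T g (T h x)"
begin

lemma bij_betw_T: "bij_betw (T g) (space M) (space M)"
proof (rule bij_betw_byWitness[where f' = "T (- g)"])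
  show "\<forall>x\<in>space M. T (- g) (T g x) = x"
    by (metis T_add T_zero left_minus)
  show "\<forall>x\<in>space M. T g (T (- g) x) = x"
    by (metis T_add T_zero right_minus)
qed (use measurable_space[OF T_measurable] in auto)

lemma T_image:
  assumes "A \<in> sets M"
  shows "T g ` A = T (- g) -` A \<inter> space M"
proof -
  have A: "A \<subseteq> space M"
    using assms by (rule sets.sets_into_space)
  have l: "T (- g) (T g x) = x" and r: "T g (T (- g) x) = x" if "x \<in> space M" for x
    using that by (metis T_add T_zero left_minus, metis T_add T_zero right_minus)
  show ?thesis
    using A l r measurable_space[OF T_measurable, of _ g]
    by (auto simp: image_iff subset_eq) metis
qed

end

definition strongly_mixing :: "'x measure \<Rightarrow> ('g \<Rightarrow> 'x \<Rightarrow> 'x) \<Rightarrow> bool" where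
  "strongly_mixing M T \<longleftrightarrow>
    (\<forall>\<epsilon>>0. \<forall>A\<in>sets M. \<forall>B\<in>sets M. measure M A > 0 \<longrightarrow> measure M B > 0 \<longrightarrow>
      finite (- {g. \<bar>measure M (A \<inter> T g ` B) - measure M A * measure M B\<bar> < \<epsilon>}))"

text \<open>
  The indices are not required to be distinct, so a difference set always contains \<open>0\<close>.
\<close>

definition difference_set :: "(nat \<Rightarrow> 'g::ab_group_add) \<Rightarrow> 'g set" where
  "difference_set x = {x n - x m | m n. True}"

definition Delta_set :: "'g::ab_group_add set \<Rightarrow> bool" where
  "Delta_set D \<longleftrightarrow> (\<exists>x. infinite (difference_set x) \<and> difference_set x \<subseteq> D)"

definition Delta_star_set :: "'g::ab_group_add set \<Rightarrow> bool" where
  "Delta_star_set D \<longleftrightarrow> (\<forall>E. Delta_set E \<longrightarrow> D \<inter> E \<noteq> {})"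

end

theory Submission
  imports Defs "HOL-Library.Ramsey"
begin

text \<open>
  If a system is strongly mixing, then the set of good return times of \<open>A\<close> is cofinite, and a
  cofinite set meets every infinite set, in particular every \<open>\<triangle>\<close>-set.

  Conversely, suppose that \<open>A\<close> and \<open>T\<^sub>g B\<close> have covariance at least \<open>\<epsilon>\<close> in absolute value for
  infinitely many \<open>g\<close>; infinitely many of these covariances then have the same sign. The return times
  \<open>f\<close> at which \<open>B\<close> and \<open>T\<^sub>f B\<close> have covariance below \<open>\<epsilon>\<^sup>2 / 2\<close> form a symmetric \<open>\<triangle>\<^sup>*\<close>-set \<open>D\<close>. Ramsey's
  theorem (\<open>Delta_star_set_infinite_clique\<close>) produces an infinite set \<open>Y\<close> of such \<open>g\<close> all of whose
  nonzero differences lie in \<open>D\<close>, so that the sets \<open>T\<^sub>g B\<close>, \<open>g \<in> Y\<close>, are pairwise almost uncorrelated.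
  But then the centred indicator of the average of \<open>n\<close> of them has squared \<open>L\<^sup>2\<close> norm at most
  \<open>1 / n + \<epsilon>\<^sup>2 / 2\<close>, whereas its integral over \<open>A\<close> is at least \<open>\<epsilon>\<close> in absolute value. By Cauchy--Schwarz
  (\<open>sum_covariance_square_le\<close>) this fails for large \<open>n\<close>.

  The argument takes place in an arbitrary abelian group (\<open>strongly_mixing_iff_Delta_star\<close>), of which
  the additive group of polynomials over a finite field is an instance.
\<close>

section \<open>Infinite cliques of differences\<close>

text \<open>
  Colour a pair \<open>{x, y}\<close> according to whether \<open>x - y\<close> lies in \<open>D\<close>; symmetry of \<open>D\<close> makes this well
  defined. The differences of an infinite set whose pairs all have the bad colour would form a
  \<open>\<triangle>\<close>-set disjoint from \<open>D\<close>. Since every \<open>\<triangle>\<close>-set contains \<open>0\<close>, the assumption \<open>0 \<notin> D\<close> is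
  indispensable: \<open>D = {0}\<close> is a \<open>\<triangle>\<^sup>*\<close>-set.
\<close>

lemma Delta_star_set_infinite_clique:
  fixes D Z :: "'g::ab_group_add set"
  assumes star: "Delta_star_set D"
    and sym: "\<And>x. x \<in> D \<Longrightarrow> - x \<in> D"
    and zero: "0 \<notin> D"
    and Z: "infinite Z"
  obtains Y where "Y \<subseteq> Z" "infinite Y" "\<And>x y. x \<in> Y \<Longrightarrow> y \<in> Y \<Longrightarrow> x \<noteq> y \<Longrightarrow> x - y \<in> D"
proof -
  define c :: "'g set \<Rightarrow> nat" where "c e = (if \<exists>x y. e = {x, y} \<and> x - y \<in> D then 0 else 1)" for e
  have c: "c {x, y} = 0 \<longleftrightarrow> x - y \<in> D" for x y
  proof -
    have "x - y \<in> D" if "y - x \<in> D"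
      using sym[OF that] by simp
    then show ?thesis
      by (auto simp: c_def doubleton_eq_iff)
  qed
  have "\<forall>x\<in>Z. \<forall>y\<in>Z. x \<noteq> y \<longrightarrow> c {x, y} < 2"
    by (simp add: c_def)
  from Ramsey2[OF Z this] obtain Y t where Y: "Y \<subseteq> Z" "infinite Y"
    and t: "\<forall>x\<in>Y. \<forall>y\<in>Y. x \<noteq> y \<longrightarrow> c {x, y} = t"
    by (elim exE conjE)
  have "t = 0"
  proof (rule ccontr)
    assume "t \<noteq> 0"
    then have bad: "x - y \<notin> D" if "x \<in> Y" "y \<in> Y" for x y
      using \<open>t \<noteq> 0\<close> that t c[of x y] zero by (cases "x = y") auto
    obtain s :: "nat \<Rightarrow> 'g" where s: "inj s" "range s \<subseteq> Y"
      using infinite_countable_subset[OF Y(2)] by blast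
    have "infinite ((\<lambda>n. s n - s 0) ` UNIV)"
      using s(1) by (intro range_inj_infinite) (auto simp: inj_def)
    moreover have "(\<lambda>n. s n - s 0) ` UNIV \<subseteq> difference_set s"
      by (auto simp: difference_set_def)
    ultimately have "Delta_set (difference_set s)"
      unfolding Delta_set_def using finite_subset by blast
    then have "D \<inter> difference_set s \<noteq> {}"
      using star unfolding Delta_star_set_def by blast
    with bad s(2) show False
      by (auto simp: difference_set_def subset_eq)
  qed
  then have "x - y \<in> D" if "x \<in> Y" "y \<in> Y" "x \<noteq> y" for x y
    using that t c[of x y] by auto
  with Y show thesis
    by (rule that)
qed

section \<open>Covariances of events\<close>

text \<open>
  With \<open>f\<close> the sum of the centred indicators of the events \<open>E i\<close>, this is Cauchy--Schwarz for
  \<open>f\<close> and the indicator of \<open>A\<close>, whose norm is at most 1. It takes the form that the variance of the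
  product of the two is nonnegative.
\<close>

lemma (in prob_space) sum_covariance_square_le:
  assumes F: "finite F" and A: "A \<in> events" and E: "\<And>i. i \<in> F \<Longrightarrow> E i \<in> events"
  shows "(\<Sum>i\<in>F. prob (A \<inter> E i) - prob A * prob (E i))\<^sup>2
    \<le> (\<Sum>i\<in>F. \<Sum>j\<in>F. prob (E i \<inter> E j) - prob (E i) * prob (E j))"
proof -
  define f :: "'a \<Rightarrow> real" where "f x = (\<Sum>i\<in>F. indicator (E i) x - prob (E i))" for x
  have ind: "integrable M (\<lambda>x. indicator B x :: real)" if "B \<in> events" for B
    using that by (simp add: integrable_real_indicator emeasure_eq_measure)
  have int_ind: "expectation (\<lambda>x. indicator B x) = prob B" if "B \<in> events" for B
    using that sets.sets_into_space[OF that] by (simp add: Int_absorb2)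
  have f_sq: "(f x)\<^sup>2 = (\<Sum>i\<in>F. \<Sum>j\<in>F. indicator (E i \<inter> E j) x - prob (E j) * indicator (E i) x
      - prob (E i) * indicator (E j) x + prob (E i) * prob (E j))" for x
    unfolding f_def power2_eq_square sum_product
    by (intro sum.cong refl) (simp add: algebra_simps indicator_inter_arith)
  have A_f: "indicator A x * f x = (\<Sum>i\<in>F. indicator (A \<inter> E i) x - prob (E i) * indicator A x)" for x
    unfolding f_def sum_distrib_left
    by (intro sum.cong refl) (simp add: algebra_simps indicator_inter_arith)
  have int_f_sq: "integrable M (\<lambda>x. (f x)\<^sup>2)"
    unfolding f_sq using E
    by (intro Bochner_Integration.integrable_sum Bochner_Integration.integrable_add
        Bochner_Integration.integrable_diff integrable_mult_right ind) auto
  have exp_f_sq: "expectation (\<lambda>x. (f x)\<^sup>2)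
      = (\<Sum>i\<in>F. \<Sum>j\<in>F. prob (E i \<inter> E j) - prob (E i) * prob (E j))"
    unfolding f_sq using E by (simp add: ind int_ind sets.Int prob_space cong: sum.cong)
  have int_A_f: "integrable M (\<lambda>x. indicator A x * f x)"
    unfolding A_f using E A
    by (intro Bochner_Integration.integrable_sum Bochner_Integration.integrable_diff
        integrable_mult_right ind) auto
  have exp_A_f: "expectation (\<lambda>x. indicator A x * f x)
      = (\<Sum>i\<in>F. prob (A \<inter> E i) - prob A * prob (E i))"
    unfolding A_f using E A by (simp add: ind int_ind sets.Int mult.commute cong: sum.cong)
  have A_f_sq: "(indicator A x * f x)\<^sup>2 = indicator A x * (f x)\<^sup>2" for x
    by (simp add: indicator_def)
  have int_A_f_sq: "integrable M (\<lambda>x. (indicator A x * f x)\<^sup>2)"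
    unfolding A_f_sq using integrable_mult_indicator[OF A int_f_sq] by simp
  have "(expectation (\<lambda>x. indicator A x * f x))\<^sup>2 \<le> expectation (\<lambda>x. (indicator A x * f x)\<^sup>2)"
    using variance_eq[OF int_A_f int_A_f_sq] variance_positive[of "\<lambda>x. indicator A x * f x"] by simp
  also have "\<dots> \<le> expectation (\<lambda>x. (f x)\<^sup>2)"
    by (intro integral_mono int_A_f_sq int_f_sq) (simp add: indicator_def)
  finally show ?thesis
    by (simp only: exp_A_f exp_f_sq)
qed

lemma (in prob_space) abs_covariance_le_1:
  assumes "A \<in> events" "B \<in> events"
  shows "\<bar>prob (A \<inter> B) - prob A * prob B\<bar> \<le> 1"
proof -
  have "0 \<le> prob A * prob B" "prob A * prob B \<le> 1"
    by (auto intro: mult_le_one)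
  then show ?thesis
    using prob_le_1[of "A \<inter> B"] measure_nonneg[of M "A \<inter> B"] by linarith
qed

text \<open>
  For a subfamily of size \<open>n\<close>, the previous inequality bounds \<open>(n \<epsilon>)\<^sup>2\<close> by \<open>n + n\<^sup>2 \<epsilon>\<^sup>2 / 2\<close>, the first
  summand coming from the diagonal. The common sign \<open>s\<close> prevents cancellation on the left-hand side.
\<close>

lemma (in prob_space) finite_correlated_family:
  assumes A: "A \<in> events" and E: "\<And>i. i \<in> Y \<Longrightarrow> E i \<in> events" and \<epsilon>: "\<epsilon> > 0"
    and s: "\<bar>s\<bar> = 1"
    and corr: "\<And>i. i \<in> Y \<Longrightarrow> \<epsilon> \<le> s * (prob (A \<inter> E i) - prob A * prob (E i))"
    and uncorr: "\<And>i j. i \<in> Y \<Longrightarrow> j \<in> Y \<Longrightarrow> i \<noteq> j \<Longrightarrow>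
      \<bar>prob (E i \<inter> E j) - prob (E i) * prob (E j)\<bar> \<le> \<epsilon>\<^sup>2 / 2"
  shows "finite Y"
proof (rule ccontr)
  assume "infinite Y"
  obtain n :: nat where n: "2 / \<epsilon>\<^sup>2 < n"
    using reals_Archimedean2 by blast
  obtain F where F: "F \<subseteq> Y" "finite F" "card F = n"
    using infinite_arbitrarily_large[OF \<open>infinite Y\<close>] by blast
  let ?cA = "\<lambda>i. prob (A \<inter> E i) - prob A * prob (E i)"
  let ?c = "\<lambda>i j. prob (E i \<inter> E j) - prob (E i) * prob (E j)"
  have "real n * \<epsilon> \<le> (\<Sum>i\<in>F. s * ?cA i)"
    using sum_bounded_below[of F \<epsilon> "\<lambda>i. s * ?cA i"] corr F by auto
  also have "\<dots> \<le> \<bar>\<Sum>i\<in>F. ?cA i\<bar>"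
    using abs_ge_self[of "s * (\<Sum>i\<in>F. ?cA i)"] s by (simp add: abs_mult flip: sum_distrib_left)
  finally have "(real n * \<epsilon>)\<^sup>2 \<le> (\<Sum>i\<in>F. ?cA i)\<^sup>2"
    using \<epsilon> by (simp add: abs_le_square_iff[symmetric])
  also have "\<dots> \<le> (\<Sum>i\<in>F. \<Sum>j\<in>F. ?c i j)"
    using F E by (intro sum_covariance_square_le A) auto
  also have "\<dots> \<le> (\<Sum>i\<in>F. \<Sum>j\<in>F. (if i = j then 1 else 0) + \<epsilon>\<^sup>2 / 2)"
  proof (intro sum_mono)
    fix i j assume "i \<in> F" "j \<in> F"
    then have ij: "i \<in> Y" "j \<in> Y"
      using F by auto
    show "?c i j \<le> (if i = j then 1 else 0) + \<epsilon>\<^sup>2 / 2"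
    proof (cases "i = j")
      case True
      have "?c i j \<le> 1"
        using abs_covariance_le_1[OF E[OF ij(1)] E[OF ij(2)]] by linarith
      moreover have "0 \<le> \<epsilon>\<^sup>2 / 2"
        by simp
      ultimately show ?thesis
        unfolding if_P[OF True] by linarith
    next
      case False
      then show ?thesis
        unfolding if_not_P[OF False] using uncorr[OF ij False] by linarith
    qed
  qed
  also have "\<dots> = real n + (real n)\<^sup>2 * (\<epsilon>\<^sup>2 / 2)"
    using F by (simp add: sum.distrib power2_eq_square algebra_simps)
  finally have "(real n)\<^sup>2 * (\<epsilon>\<^sup>2 / 2) \<le> real n"
    by (simp add: power_mult_distrib)
  moreover have "0 < real n" "1 < real n * (\<epsilon>\<^sup>2 / 2)"
    using n \<epsilon> by (auto simp: field_simps intro!: gr0I)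
  then have "real n * 1 < real n * (real n * (\<epsilon>\<^sup>2 / 2))"
    by (intro mult_strict_left_mono)
  ultimately show False
    by (simp add: power2_eq_square mult.assoc)
qed

section \<open>Correlations along a measure preserving action\<close>

context measure_preserving_action
begin

lemma sets_T_image: "B \<in> events \<Longrightarrow> T g ` B \<in> events"
  by (subst T_image) (auto intro: measurable_sets[OF T_measurable])

lemma prob_T_image: "B \<in> events \<Longrightarrow> prob (T g ` B) = prob B"
  by (subst T_image) (simp_all add: measure_def T_preserving)

lemma T_image_zero:
  assumes "B \<in> events"
  shows "T 0 ` B = B"
proof -
  have "T 0 ` B = (\<lambda>x. x) ` B"
    using T_zero sets.sets_into_space[OF assms] by (intro image_cong) auto
  then show ?thesis
    by simp
qed

lemma prob_T_image_Int:
  assumes "B \<in> events"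
  shows "prob (T h ` B \<inter> T g ` B) = prob (B \<inter> T (- h + g) ` B)"
proof -
  have B: "B \<subseteq> space M"
    using assms by (rule sets.sets_into_space)
  have C: "T (- h + g) ` B \<in> events"
    using assms by (rule sets_T_image)
  have "T g x = T h (T (- h + g) x)" if "x \<in> B" for x
    using that B T_add[of x h "- h + g"] by (auto simp: add.assoc[symmetric])
  then have "T g ` B = T h ` T (- h + g) ` B"
    by (simp add: image_image cong: image_cong)
  then have "T h ` B \<inter> T g ` B = T h ` (B \<inter> T (- h + g) ` B)"
    using inj_on_image_Int[OF bij_betw_imp_inj_on[OF bij_betw_T[of h]] B
        sets.sets_into_space[OF C]] by simp
  with assms C show ?thesis
    by (simp add: prob_T_image)
qed

lemma prob_Int_T_image_uminus:
  assumes "B \<in> events"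
  shows "prob (B \<inter> T (- f) ` B) = prob (B \<inter> T f ` B)"
  using prob_T_image_Int[OF assms, of f 0] by (simp add: T_image_zero[OF assms] Int_commute)

end

section \<open>Strong mixing and return times\<close>

lemma Delta_star_set_if_finite_Compl:
  assumes "finite (- D)"
  shows "Delta_star_set D"
  unfolding Delta_star_set_def Delta_set_def
  using assms by (blast dest: finite_subset[rotated])

theorem strongly_mixing_iff_Delta_star:
  fixes M :: "'x measure" and T :: "'g::ab_group_add \<Rightarrow> 'x \<Rightarrow> 'x"
  assumes "measure_preserving_action M T"
  shows "strongly_mixing M T \<longleftrightarrow>
    (\<forall>\<epsilon>>0. \<forall>A\<in>sets M. measure M A > 0 \<longrightarrow>
      Delta_star_set {f. \<bar>measure M (A \<inter> T f ` A) - (measure M A)\<^sup>2\<bar> < \<epsilon>})"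
    (is "_ \<longleftrightarrow> ?returns")
proof
  assume "strongly_mixing M T"
  then show ?returns
    unfolding strongly_mixing_def power2_eq_square
    by (blast intro: Delta_star_set_if_finite_Compl)
next
  assume ?returns
  interpret measure_preserving_action M T
    by fact
  show "strongly_mixing M T"
    unfolding strongly_mixing_def
  proof (intro allI ballI impI)
    fix \<epsilon> :: real and A B
    assume \<epsilon>: "\<epsilon> > 0" and A: "A \<in> events" and B: "B \<in> events" and "prob B > 0"
    define cov where "cov g = prob (A \<inter> T g ` B) - prob A * prob (T g ` B)" for g
    define D where "D = {f. \<bar>prob (B \<inter> T f ` B) - (prob B)\<^sup>2\<bar> < \<epsilon>\<^sup>2 / 2}"
    have D: "Delta_star_set D"
      using \<open>?returns\<close>[rule_format, OF _ B \<open>prob B > 0\<close>, of "\<epsilon>\<^sup>2 / 2"] \<epsilon> unfolding D_def by simp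
    have D_sym: "- f \<in> D" if "f \<in> D" for f
      using that B by (simp add: D_def prob_Int_T_image_uminus)
    have fin: "finite {g. \<epsilon> \<le> s * cov g}" if s: "\<bar>s\<bar> = 1" for s :: real
    proof (rule ccontr)
      let ?Z = "{g. \<epsilon> \<le> s * cov g}"
      assume Z: "infinite ?Z"
      then obtain g where g: "\<epsilon> \<le> s * cov g"
        using not_finite_existsD by blast
      \<comment> \<open>A single \<open>g\<close> already gives \<open>\<epsilon>\<^sup>2 \<le> Var(1\<^sub>B) = prob B - (prob B)\<^sup>2\<close>, which keeps \<open>0\<close> out of \<open>D\<close>.\<close>
      have "\<epsilon> \<le> \<bar>cov g\<bar>"
        using order_trans[OF g abs_ge_self] s by (simp add: abs_mult)
      then have "\<epsilon>\<^sup>2 \<le> (cov g)\<^sup>2"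
        using \<epsilon> by (simp add: abs_le_square_iff[symmetric])
      also have "\<dots> \<le> prob B - (prob B)\<^sup>2"
        using sum_covariance_square_le[of "{g}" A "\<lambda>g. T g ` B"] A B
        by (simp add: cov_def sets_T_image prob_T_image power2_eq_square)
      finally have "\<epsilon>\<^sup>2 \<le> prob B - (prob B)\<^sup>2" .
      moreover have "0 < \<epsilon>\<^sup>2"
        using \<epsilon> by simp
      ultimately have "\<not> \<bar>prob B - (prob B)\<^sup>2\<bar> < \<epsilon>\<^sup>2 / 2"
        by linarith
      then have "0 \<notin> D"
        using B by (simp only: D_def T_image_zero mem_Collect_eq Int_absorb not_False_eq_True)
      then obtain Y where Y: "Y \<subseteq> ?Z" "infinite Y"
        "\<And>x y. x \<in> Y \<Longrightarrow> y \<in> Y \<Longrightarrow> x \<noteq> y \<Longrightarrow> x - y \<in> D"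
        using Delta_star_set_infinite_clique[OF D D_sym _ Z] by metis
      have "finite Y"
      proof (rule finite_correlated_family[OF A _ \<epsilon> s])
        show "T g ` B \<in> events" for g
          using B by (rule sets_T_image)
        show "\<epsilon> \<le> s * (prob (A \<inter> T g ` B) - prob A * prob (T g ` B))" if "g \<in> Y" for g
          using that Y(1) by (auto simp: cov_def)
        show "\<bar>prob (T h ` B \<inter> T g ` B) - prob (T h ` B) * prob (T g ` B)\<bar> \<le> \<epsilon>\<^sup>2 / 2"
          if "h \<in> Y" "g \<in> Y" "h \<noteq> g" for g h
        proof -
          have "- h + g \<in> D"
            using Y(3)[of g h] that by simp
          then show ?thesis
            using B by (simp add: D_def prob_T_image_Int prob_T_image power2_eq_square)
        qed
      qed
      with Y(2) show False
        by blast
    qed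
    have "- {g. \<bar>prob (A \<inter> T g ` B) - prob A * prob B\<bar> < \<epsilon>}
        \<subseteq> {g. \<epsilon> \<le> 1 * cov g} \<union> {g. \<epsilon> \<le> - 1 * cov g}"
      using B by (auto simp: cov_def prob_T_image)
    then show "finite (- {g. \<bar>prob (A \<inter> T g ` B) - prob A * prob B\<bar> < \<epsilon>})"
      by (rule finite_subset) (intro finite_UnI fin; simp)
  qed
qed

theorem theorem9:
  fixes q :: nat
    and M :: "'x measure"
    and T :: "'a::{field, finite} poly \<Rightarrow> 'x \<Rightarrow> 'x"
  assumes "prime q"
    and "CHAR('a) = q"
    and "measure_preserving_action M T"
  shows "strongly_mixing M T \<longleftrightarrow>
    (\<forall>\<epsilon>>0. \<forall>A\<in>sets M. measure M A > 0 \<longrightarrow>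
      Delta_star_set {f. \<bar>measure M (A \<inter> T f ` A) - (measure M A)\<^sup>2\<bar> < \<epsilon>})"
  using assms(3) by (rule strongly_mixing_iff_Delta_star)

end
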